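(* Let $\mathcal{F}=(P_1|S_1,\ldots,P_n|S_n)$ be a sequence of $n$ conditional events and let $x\in\left]\tfrac12,1\right]$. For $(p_1,\ldots,p_n)\in[0,1]^n$ write $m=\sum_{i=1}^n\frac{p_i}{n}$, and set $\mathcal{I}_{A(x)}=\{(p_1,\ldots,p_n)\in[0,1]^n: m\ge x\}$, $\mathcal{I}_{E(x)}=\{(p_1,\ldots,p_n)\in[0,1]^n: m\le 1-x\}$, $\mathcal{I}_{I(x)}=\{(p_1,\ldots,p_n)\in[0,1]^n: m>1-x\}$, $\mathcal{I}_{O(x)}=\{(p_1,\ldots,p_n)\in[0,1]^n: m<x\}$, $\mathcal{I}_{U(x)}=\{(p_1,\ldots,p_n)\in[0,1]^n: m\ge x\text{ or }m\le 1-x\}$, $\mathcal{I}_{Y(x)}=\{(p_1,\ldots,p_n)\in[0,1]^n: 1-x<m<x\}$. Let $A(x):(\mathcal{F},\mathcal{I}_{A(x)})$, $E(x):(\mathcal{F},\mathcal{I}_{E(x)})$, $I(x):(\mathcal{F},\mathcal{I}_{I(x)})$, $O(x):(\mathcal{F},\mathcal{I}_{O(x)})$, $U(x):(\mathcal{F},\mathcal{I}_{U(x)})$, $Y(x):(\mathcal{F},\mathcal{I}_{Y(x)})$. Then $(A(x),E(x),I(x),O(x),U(x),Y(x))$ is a hexagon of opposition.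
   Context: Events are two-valued logical entities (they can be modelled as subsets of a nonempty set $\Omega$ of possible cases); an event is identified with its indicator in $\{0,1\}$. A conditional event $E|H$ is given by events $E,H$ with $H\neq\bot$ (impossible event). No logical independence is assumed. Given $\mathcal{F}=(E_1|H_1,\ldots,E_n|H_n)$, a precise assessment on $\mathcal{F}$ is a vector $\mathcal{P}=(p_1,\ldots,p_n)$, $p_i=p(E_i|H_i)$. It is coherent iff for every nonempty subfamily, indexed by $J\subseteq\{1,\ldots,n\}$, and all real numbers $s_j$ ($j\in J$), the random gain $\mathcal{G}=\sum_{j\in J}s_jH_j(E_j-p_j)$ satisfies $\min G\le 0\le\max G$, where $G$ is the set of values of $\mathcal{G}$ restricted to $\bigvee_{j\in J}H_j$ being true. $\Pi$ denotes the set of all coherent precise assessments on $\mathcal{F}$; it is known that $\emptyset\neq\Pi\subseteq[0,1]^n$. For $\mathcal{I}\subseteq[0,1]^n$ write $\pi(\mathcal{I})=\Pi\cap\mathcal{I}$. A sentence is a pair $s:(\mathcal{F},\mathcal{I})$ with $\mathcal{I}\subseteq[0,1]^n$ (possibly empty). Operations: $s_1\wedge s_2:(\mathcal{F},\mathcal{I}_1\cap\mathcal{I}_2)$, $s_1\vee s_2:(\mathcal{F},\mathcal{I}_1\cup\mathcal{I}_2)$. Sentences $s:(\mathcal{F},\mathcal{I})$ and $s':(\mathcal{F},\mathcal{I}')$ are equivalent under t-coherence, $s\equiv s'$, iff $\pi(\mathcal{I})=\pi(\mathcal{I}')$. A quadruple $(s_1,s_2,s_3,s_4)$ of sentences $s_k:(\mathcal{F},\mathcal{I}_k)$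 is a square of opposition iff: (a) (contraries) $\pi(\mathcal{I}_1)\cap\pi(\mathcal{I}_2)=\emptyset$; (b) (subcontraries) $\pi(\mathcal{I}_3)\cup\pi(\mathcal{I}_4)=\Pi$; (c) (contradictories) $\pi(\mathcal{I}_1)\cap\pi(\mathcal{I}_4)=\emptyset$, $\pi(\mathcal{I}_1)\cup\pi(\mathcal{I}_4)=\Pi$, $\pi(\mathcal{I}_2)\cap\pi(\mathcal{I}_3)=\emptyset$, $\pi(\mathcal{I}_2)\cup\pi(\mathcal{I}_3)=\Pi$; (d) (subalterns) $\pi(\mathcal{I}_1)\subseteq\pi(\mathcal{I}_3)$ and $\pi(\mathcal{I}_2)\subseteq\pi(\mathcal{I}_4)$. A tuple $(s_1,\ldots,s_6)$ of sentences on $\mathcal{F}$ is a hexagon of opposition iff $(s_1,s_2,s_3,s_4)$ is a square of opposition, $s_5\equiv s_1\vee s_2$, and $s_6\equiv s_3\wedge s_4$. *)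

theory Defs
  imports "HOL-Analysis.Analysis"
begin

text \<open>
  Events are subsets of the set of possible cases, which is the (nonempty) type \<open>'w\<close>.
  The pair \<open>(E, H)\<close> stands for the conditional event \<open>E|H\<close>. A family of \<open>n\<close> conditional
  events is indexed by a finite type \<open>'n\<close> with \<open>n = CARD('n)\<close>, so \<open>n \<ge> 1\<close>.
\<close>

type_synonym 'w event = "'w set"
type_synonym 'w cond_event = "'w event \<times> 'w event"
type_synonym ('w, 'n) family = "'n \<Rightarrow> 'w cond_event"

definition is_cond_event :: "'w cond_event \<Rightarrow> bool" where
  "is_cond_event C \<longleftrightarrow> snd C \<noteq> {}"

definition is_family :: "('w, 'n) family \<Rightarrow> bool" where
  "is_family F \<longleftrightarrow> (\<forall>i. is_cond_event (F i))"

definition random_gain ::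
  "('w, 'n::finite) family \<Rightarrow> real ^ 'n \<Rightarrow> 'n set \<Rightarrow> ('n \<Rightarrow> real) \<Rightarrow> 'w \<Rightarrow> real" where
  "random_gain F p J s w =
     (\<Sum>j\<in>J. s j * indicator (snd (F j)) w * (indicator (fst (F j)) w - p $ j))"

definition gain_values ::
  "('w, 'n::finite) family \<Rightarrow> real ^ 'n \<Rightarrow> 'n set \<Rightarrow> ('n \<Rightarrow> real) \<Rightarrow> real set" where
  "gain_values F p J s = random_gain F p J s ` (\<Union>j\<in>J. snd (F j))"

text \<open>
  Even if \<open>'w\<close> is infinite, \<open>gain_values F p J s\<close> is finite, since the gain depends only on
  the truth values of finitely many events; so \<open>Min\<close> and \<open>Max\<close> are meaningful below.
\<close>

lemma finite_gain_values: "finite (gain_values F p J s)"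
proof -
  let ?c = "\<lambda>w. ({j. w \<in> snd (F j)}, {j. w \<in> fst (F j)})"
  let ?g = "\<lambda>(A, B). \<Sum>j\<in>J. s j * indicator A j * (indicator B j - p $ j)"
  have "random_gain F p J s = ?g \<circ> ?c"
    by (auto simp: random_gain_def fun_eq_iff indicator_def)
  then have "gain_values F p J s \<subseteq> range ?g"
    unfolding gain_values_def by auto
  then show ?thesis
    by (rule finite_subset) simp
qed

definition coherent :: "('w, 'n::finite) family \<Rightarrow> real ^ 'n \<Rightarrow> bool" where
  "coherent F p \<longleftrightarrow>
     (\<forall>J s. J \<noteq> {} \<longrightarrow> Min (gain_values F p J s) \<le> 0 \<and> 0 \<le> Max (gain_values F p J s))"

definition coherent_set :: "('w, 'n::finite) family \<Rightarrow> (real ^ 'n) set" where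
  "coherent_set F = {p. coherent F p}"

definition unit_cube :: "(real ^ 'n::finite) set" where
  "unit_cube = {p. \<forall>i. 0 \<le> p $ i \<and> p $ i \<le> 1}"

type_synonym ('w, 'n) sentence = "('w, 'n) family \<times> (real ^ 'n) set"

definition sentence_on :: "('w, 'n::finite) family \<Rightarrow> ('w, 'n) sentence \<Rightarrow> bool" where
  "sentence_on F s \<longleftrightarrow> is_family F \<and> fst s = F \<and> snd s \<subseteq> unit_cube"

definition coherent_part :: "('w, 'n::finite) sentence \<Rightarrow> (real ^ 'n) set" where
  "coherent_part s = coherent_set (fst s) \<inter> snd s"

text \<open>Conjunction and disjunction are only meaningful for sentences on the same family.\<close>

definition sentence_conj ::
  "('w, 'n::finite) sentence \<Rightarrow> ('w, 'n) sentence \<Rightarrow> ('w, 'n) sentence" where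
  "sentence_conj s1 s2 = (fst s1, snd s1 \<inter> snd s2)"

definition sentence_disj ::
  "('w, 'n::finite) sentence \<Rightarrow> ('w, 'n) sentence \<Rightarrow> ('w, 'n) sentence" where
  "sentence_disj s1 s2 = (fst s1, snd s1 \<union> snd s2)"

definition t_equiv :: "('w, 'n::finite) sentence \<Rightarrow> ('w, 'n) sentence \<Rightarrow> bool" where
  "t_equiv s s' \<longleftrightarrow> fst s = fst s' \<and> coherent_part s = coherent_part s'"

definition square_of_opposition ::
  "('w, 'n::finite) family \<Rightarrow> ('w, 'n) sentence \<Rightarrow> ('w, 'n) sentence
    \<Rightarrow> ('w, 'n) sentence \<Rightarrow> ('w, 'n) sentence \<Rightarrow> bool" where
  "square_of_opposition F s1 s2 s3 s4 \<longleftrightarrow>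
     sentence_on F s1 \<and> sentence_on F s2 \<and> sentence_on F s3 \<and> sentence_on F s4 \<and>
     coherent_part s1 \<inter> coherent_part s2 = {} \<and>
     coherent_part s3 \<union> coherent_part s4 = coherent_set F \<and>
     coherent_part s1 \<inter> coherent_part s4 = {} \<and>
     coherent_part s1 \<union> coherent_part s4 = coherent_set F \<and>
     coherent_part s2 \<inter> coherent_part s3 = {} \<and>
     coherent_part s2 \<union> coherent_part s3 = coherent_set F \<and>
     coherent_part s1 \<subseteq> coherent_part s3 \<and>
     coherent_part s2 \<subseteq> coherent_part s4"

definition hexagon_of_opposition ::
  "('w, 'n::finite) family \<Rightarrow> ('w, 'n) sentence \<Rightarrow> ('w, 'n) sentence
    \<Rightarrow> ('w, 'n) sentence \<Rightarrow> ('w, 'n) sentence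
    \<Rightarrow> ('w, 'n) sentence \<Rightarrow> ('w, 'n) sentence \<Rightarrow> bool" where
  "hexagon_of_opposition F s1 s2 s3 s4 s5 s6 \<longleftrightarrow>
     sentence_on F s5 \<and> sentence_on F s6 \<and>
     square_of_opposition F s1 s2 s3 s4 \<and>
     t_equiv s5 (sentence_disj s1 s2) \<and>
     t_equiv s6 (sentence_conj s3 s4)"

definition mean :: "real ^ 'n::finite \<Rightarrow> real" where
  "mean p = (\<Sum>i\<in>UNIV. p $ i / real CARD('n))"

definition region_A :: "real \<Rightarrow> (real ^ 'n::finite) set" where
  "region_A x = {p \<in> unit_cube. mean p \<ge> x}"

definition region_E :: "real \<Rightarrow> (real ^ 'n::finite) set" where
  "region_E x = {p \<in> unit_cube. mean p \<le> 1 - x}"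

definition region_I :: "real \<Rightarrow> (real ^ 'n::finite) set" where
  "region_I x = {p \<in> unit_cube. mean p > 1 - x}"

definition region_O :: "real \<Rightarrow> (real ^ 'n::finite) set" where
  "region_O x = {p \<in> unit_cube. mean p < x}"

definition region_U :: "real \<Rightarrow> (real ^ 'n::finite) set" where
  "region_U x = {p \<in> unit_cube. mean p \<ge> x \<or> mean p \<le> 1 - x}"

definition region_Y :: "real \<Rightarrow> (real ^ 'n::finite) set" where
  "region_Y x = {p \<in> unit_cube. 1 - x < mean p \<and> mean p < x}"

end

theory Submission
  imports Defs
begin

text \<open>
  Within the unit cube every condition of the hexagon is a statement about the single number
  \<open>mean p\<close> and the two thresholds \<open>1 - x < x\<close>: the regions \<open>A\<close> and \<open>O\<close> are separated by the
  threshold \<open>x\<close>, the regions \<open>E\<close> and \<open>I\<close> by \<open>1 - x\<close>, and the strict inequality \<open>1 - x < x\<close>,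
  which is where \<open>x > 1/2\<close> enters, makes \<open>A\<close> and \<open>E\<close> disjoint and yields the subalternations.
  The conditions that ask for the union of two coherent parts to be \<^emph>\<open>all\<close> of
  \<open>coherent_set F\<close> also require that no coherent assessment lies outside the unit cube.
  This is the only use of coherence (\<open>coherent_set_subset_unit_cube\<close>): already a bet on one
  conditional event \<open>E|H\<close> gives a sure gain or a sure loss if its price is outside \<open>[0, 1]\<close>.
\<close>

text \<open>
  A unit stake on the single event \<open>i\<close> gains either \<open>1 - p\<^sub>i\<close> or \<open>- p\<^sub>i\<close>. Coherence demands
  that some gain be nonpositive, hence \<open>p\<^sub>i \<ge> 0\<close>, and that some gain be nonnegative, hence
  \<open>p\<^sub>i \<le> 1\<close>.
\<close>

lemma coherent_set_subset_unit_cube: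
  fixes F :: "('w, 'n::finite) family"
  assumes "is_family F"
  shows "coherent_set F \<subseteq> unit_cube"
proof
  fix p assume "p \<in> coherent_set F"
  then have coh: "coherent F p" by (simp add: coherent_set_def)
  show "p \<in> unit_cube"
    unfolding unit_cube_def
  proof (intro CollectI allI)
    fix i
    let ?G = "gain_values F p {i} (\<lambda>_. 1)"
    have ne: "?G \<noteq> {}"
      using assms by (auto simp: gain_values_def is_family_def is_cond_event_def)
    have val: "g = 1 - p $ i \<or> g = - p $ i" if "g \<in> ?G" for g
      using that by (auto simp: gain_values_def random_gain_def indicator_def)
    have "Min ?G \<le> 0" "0 \<le> Max ?G"
      using coh by (auto simp: coherent_def)
    moreover have "Min ?G \<in> ?G" "Max ?G \<in> ?G"
      using ne by (simp_all add: finite_gain_values)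
    ultimately show "0 \<le> p $ i \<and> p $ i \<le> 1"
      using val[of "Min ?G"] val[of "Max ?G"] by linarith
  qed
qed

theorem mainTheorem8:
  fixes F :: "('w, 'n::finite) family"
    and x :: real
  assumes "is_family F"
    and "x \<in> {1/2<..1}"
  shows "hexagon_of_opposition F
           (F, region_A x) (F, region_E x) (F, region_I x)
           (F, region_O x) (F, region_U x) (F, region_Y x)"
proof -
  note regions = region_A_def region_E_def region_I_def region_O_def region_U_def region_Y_def
  have thresholds: "1 - x < x"
    using assms(2) by simp
  have "square_of_opposition F (F, region_A x) (F, region_E x) (F, region_I x) (F, region_O x)"
    using assms(1) thresholds coherent_set_subset_unit_cube[OF assms(1)]
    by (auto simp: square_of_opposition_def sentence_on_def coherent_part_def regions)
  moreover have "t_equiv (F, region_U x) (sentence_disj (F, region_A x) (F, region_E x))"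
    by (auto simp: t_equiv_def sentence_disj_def coherent_part_def regions)
  moreover have "t_equiv (F, region_Y x) (sentence_conj (F, region_I x) (F, region_O x))"
    by (auto simp: t_equiv_def sentence_conj_def coherent_part_def regions)
  moreover have "sentence_on F (F, region_U x)" "sentence_on F (F, region_Y x)"
    using assms(1) by (auto simp: sentence_on_def regions)
  ultimately show ?thesis
    by (simp add: hexagon_of_opposition_def)
qed

end
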